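(* Let $\kappa>0$, $a>0$, and let $u=u(\cdot;u_0)$, $u_0>0$, be a solution of $$\frac{u''(r)}{(1-u'(r)^2)^{3/2}}=\kappa\,u(r),\quad -a<r<a,\qquad u'(\pm a)=\pm\tanh\beta ,$$ with $|u'|<1$, $u(0)=u_0$ and $u'(0)=0$. Then $$u(a)-a\coth\beta+\sqrt{r^2+\frac{a^2}{\sinh^2\beta}}<u(r),\qquad 0\le r<a,$$ and $$u(a)<\frac{\sinh\beta}{\kappa a}+\frac{a}{2}\coth\beta-\frac{a\beta}{2\sinh^2\beta}.$$
   Context: $u(\cdot;u_0)$ denotes the unique solution on $\mathbb{R}$ of $\dfrac{u''}{(1-u'^2)^{3/2}}=\kappa u$ with $u(0)=u_0$, $u'(0)=0$. The real number $\beta$ is determined by $u'(a)=\tanh\beta$, and $\beta>0$ since $u_0>0$. *)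

theory Defs
  imports "HOL-Analysis.Analysis"
begin

definition coth :: "real \<Rightarrow> real"
  where "coth x = cosh x / sinh x"

(* u solves u'' / (1 - u'^2)^(3/2) = \<kappa> u on -a < r < a, where u' and u'' are the first and second
   derivatives of u. So that the boundary values u'(\<plusminus>a) make sense, u is C^1 up to the endpoints,
   the derivatives there being one-sided. The restriction to [-a, a] of a solution on the whole
   line satisfies this. *)
definition solves_capillary ::
    "real \<Rightarrow> real \<Rightarrow> (real \<Rightarrow> real) \<Rightarrow> (real \<Rightarrow> real) \<Rightarrow> (real \<Rightarrow> real) \<Rightarrow> bool"
  where "solves_capillary \<kappa> a u u' u'' \<longleftrightarrow>
    (\<forall>r\<in>{-a..a}. (u has_real_derivative u' r) (at r within {-a..a})) \<and>
    continuous_on {-a..a} u' \<and>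
    (\<forall>r\<in>{-a..a}. \<bar>u' r\<bar> < 1) \<and>
    (\<forall>r\<in>{-a<..<a}. (u' has_real_derivative u'' r) (at r) \<and>
       u'' r / (1 - (u' r)\<^sup>2) powr (3/2) = \<kappa> * u r)"

end

theory Submission
  imports Defs
begin

text \<open>
  In terms of the momentum \<open>w = u' / sqrt (1 - u'\<^sup>2)\<close>, the hyperbolic sine of the
  inclination angle, the equation becomes the first-order system
  \<open>u' = w / sqrt (1 + w\<^sup>2)\<close>, \<open>w' = \<kappa> u\<close>, with \<open>w 0 = 0\<close> and \<open>w a = sinh \<beta>\<close>.

  The energy \<open>\<kappa> u\<^sup>2 / 2 - sqrt (1 + w\<^sup>2)\<close> is conserved (\<open>capillary_system.energy\<close>), which keeps
  \<open>u\<close> away from zero and hence positive. So \<open>w\<close> and then \<open>u\<close> are strictly increasing, \<open>w'\<close> is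
  strictly increasing too, and the convex function \<open>w\<close> lies strictly below its chord
  \<open>r \<mapsto> r * w a / a\<close> (\<open>capillary_system.momentum_below_chord\<close>).

  The hyperbola \<open>v\<close> of constant Lorentzian curvature \<open>1 / R\<close>, \<open>R = a / sinh \<beta>\<close>, through \<open>(a, u a)\<close> has
  exactly this chord as its momentum. Hence \<open>u' < v'\<close> inside the interval while \<open>u\<close> and \<open>v\<close>
  agree at \<open>a\<close>, so \<open>v < u\<close>: this is the first claim. Integrating \<open>v < u = w' / \<kappa>\<close> over
  \<open>[0, a]\<close> bounds the area under \<open>v\<close>, which is elementary, by \<open>sinh \<beta> / \<kappa>\<close>; solving for
  \<open>u a\<close> gives the second claim.
\<close>

section \<open>Momentum and slope\<close>

definition momentum :: "real \<Rightarrow> real"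
  where "momentum p = p / sqrt (1 - p\<^sup>2)"

definition slope :: "real \<Rightarrow> real"
  where "slope s = s / sqrt (1 + s\<^sup>2)"

lemma slope_momentum:
  assumes "\<bar>p\<bar> < 1"
  shows "slope (momentum p) = p"
proof -
  have pos: "1 - p\<^sup>2 > 0"
    using assms by (simp add: abs_square_less_1)
  then have "1 + (momentum p)\<^sup>2 = 1 / (1 - p\<^sup>2)"
    by (simp add: momentum_def power_divide field_simps)
  then have "sqrt (1 + (momentum p)\<^sup>2) = 1 / sqrt (1 - p\<^sup>2)"
    by (simp add: real_sqrt_divide)
  then show ?thesis
    using pos by (simp add: slope_def momentum_def)
qed

lemma momentum_tanh: "momentum (tanh x) = sinh x"
proof -
  have "1 - (tanh x)\<^sup>2 = 1 / (cosh x)\<^sup>2"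
    by (simp add: tanh_def power_divide divide_simps) (simp add: cosh_square_eq)
  then have "sqrt (1 - (tanh x)\<^sup>2) = 1 / cosh x"
    by (simp add: real_sqrt_divide)
  then show ?thesis
    by (simp add: momentum_def tanh_def)
qed

lemma has_real_derivative_sqrt_1_plus_square:
  "((\<lambda>s. sqrt (1 + s\<^sup>2)) has_real_derivative slope s) (at s)"
proof -
  have "1 + s\<^sup>2 > 0"
    by (simp add: add_pos_nonneg)
  then show ?thesis
    unfolding slope_def by (auto intro!: derivative_eq_intros simp: field_simps)
qed

text \<open>\<open>slope s\<close> is \<open>tanh (arsinh s)\<close>, a composition of increasing functions.\<close>

lemma slope_strict_mono:
  assumes "s < t"
  shows "slope s < slope t"
proof -
  have "slope x = tanh (arsinh x)" for x
    by (simp add: slope_def tanh_def cosh_arsinh_real add.commute)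
  moreover have "arsinh s < arsinh t"
    using assms by simp
  ultimately show ?thesis
    by simp
qed

lemma has_real_derivative_momentum:
  assumes "(f has_real_derivative f') (at x)" and "\<bar>f x\<bar> < 1"
  shows "((\<lambda>x. momentum (f x)) has_real_derivative f' / (1 - (f x)\<^sup>2) powr (3/2)) (at x)"
proof -
  define q where "q = sqrt (1 - (f x)\<^sup>2)"
  have pos: "1 - (f x)\<^sup>2 > 0"
    using assms(2) by (simp add: abs_square_less_1)
  then have q: "q > 0" "q\<^sup>2 = 1 - (f x)\<^sup>2"
    by (simp_all add: q_def)
  have "(1 - (f x)\<^sup>2) powr (3/2) = ((1 - (f x)\<^sup>2) powr (1/2)) powr 3"
    by (simp add: powr_powr)
  also have "\<dots> = q ^ 3"
    using q(1) pos by (simp add: powr_half_sqrt q_def powr_numeral)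
  finally have powr: "(1 - (f x)\<^sup>2) powr (3/2) = q ^ 3" .
  have "((\<lambda>x. momentum (f x)) has_real_derivative
      (f' * q - f x * (- (f x * f') / q)) / (q * q)) (at x)"
    unfolding momentum_def q_def using pos
    by (auto intro!: derivative_eq_intros assms(1) simp: field_simps)
  moreover have "(f' * q - f x * (- (f x * f') / q)) / (q * q) = f' * (q\<^sup>2 + (f x)\<^sup>2) / q ^ 3"
    using q(1) by (simp add: field_simps power2_eq_square power3_eq_cube)
  ultimately show ?thesis
    using q(2) powr by simp
qed


section \<open>The capillary equation as a first-order system\<close>

locale capillary_system =
  fixes \<kappa> a :: real and u w :: "real \<Rightarrow> real"
  assumes kappa_pos: "\<kappa> > 0" and a_pos: "a > 0"
    and u0_pos: "u 0 > 0" and w0: "w 0 = 0"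
    and u_cont: "continuous_on {0..a} u" and w_cont: "continuous_on {0..a} w"
    and u_deriv: "\<And>r. 0 < r \<Longrightarrow> r < a \<Longrightarrow> (u has_real_derivative slope (w r)) (at r)"
    and w_deriv: "\<And>r. 0 < r \<Longrightarrow> r < a \<Longrightarrow> (w has_real_derivative \<kappa> * u r) (at r)"
begin

lemma u_cont_on: "0 \<le> x \<Longrightarrow> y \<le> a \<Longrightarrow> continuous_on {x..y} u"
  by (rule continuous_on_subset[OF u_cont]) auto

lemma w_cont_on: "0 \<le> x \<Longrightarrow> y \<le> a \<Longrightarrow> continuous_on {x..y} w"
  by (rule continuous_on_subset[OF w_cont]) auto

lemma energy:
  assumes "0 \<le> r" and "r \<le> a"
  shows "\<kappa> * (u r)\<^sup>2 / 2 - sqrt (1 + (w r)\<^sup>2) = \<kappa> * (u 0)\<^sup>2 / 2 - 1"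
proof -
  let ?E = "\<lambda>x. \<kappa> * (u x)\<^sup>2 / 2 - sqrt (1 + (w x)\<^sup>2)"
  have "(?E has_real_derivative 0) (at x)" if x: "0 < x" "x < a" for x
  proof -
    have "((\<lambda>x. \<kappa> * (u x)\<^sup>2 / 2) has_real_derivative \<kappa> * u x * slope (w x)) (at x)"
      by (auto intro!: derivative_eq_intros u_deriv[OF x])
    moreover have "((\<lambda>x. sqrt (1 + (w x)\<^sup>2)) has_real_derivative slope (w x) * (\<kappa> * u x)) (at x)"
      by (rule DERIV_chain2[OF has_real_derivative_sqrt_1_plus_square w_deriv[OF x]])
    ultimately have "(?E has_real_derivative \<kappa> * u x * slope (w x) - slope (w x) * (\<kappa> * u x)) (at x)"
      by (rule DERIV_diff)
    then show ?thesis
      by simp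
  qed
  moreover have "continuous_on {0..a} ?E"
    by (intro continuous_intros u_cont w_cont) simp
  ultimately have "?E r = ?E 0"
    using DERIV_isconst2[of 0 a ?E r] a_pos assms by blast
  then show ?thesis
    by (simp add: w0)
qed

text \<open>By conservation of energy \<open>u\<close> has no zero, so it keeps its initial sign.\<close>

lemma u_pos:
  assumes "0 \<le> r" and "r \<le> a"
  shows "u r > 0"
proof (rule ccontr)
  assume "\<not> u r > 0"
  then obtain x where x: "0 \<le> x" "x \<le> r" "u x = 0"
    using IVT2'[of u r 0 0] u0_pos assms u_cont_on[of 0 r] by auto
  have "sqrt (1 + (w x)\<^sup>2) \<ge> 1"
    by simp
  moreover have "\<kappa> * (u 0)\<^sup>2 > 0"
    using kappa_pos u0_pos by simp
  moreover have "- sqrt (1 + (w x)\<^sup>2) = \<kappa> * (u 0)\<^sup>2 / 2 - 1"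
    using energy[of x] x assms by simp
  ultimately show False
    by linarith
qed

lemma w_strict_mono:
  assumes "0 \<le> x" and "x < y" and "y \<le> a"
  shows "w x < w y"
proof (rule DERIV_pos_imp_increasing_open[OF assms(2)])
  fix t assume "x < t" "t < y"
  then show "\<exists>d. (w has_real_derivative d) (at t) \<and> 0 < d"
    using w_deriv[of t] u_pos[of t] kappa_pos assms by (intro exI[of _ "\<kappa> * u t"]) simp
qed (use w_cont_on assms in auto)

lemma w_pos: "0 < r \<Longrightarrow> r \<le> a \<Longrightarrow> w r > 0"
  using w_strict_mono[of 0 r] w0 by simp

lemma u_strict_mono:
  assumes "0 \<le> x" and "x < y" and "y \<le> a"
  shows "u x < u y"
proof (rule DERIV_pos_imp_increasing_open[OF assms(2)])
  fix t assume t: "x < t" "t < y"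
  then have "slope (w t) > 0"
    using w_pos[of t] slope_strict_mono[of 0 "w t"] assms by (simp add: slope_def)
  then show "\<exists>d. (u has_real_derivative d) (at t) \<and> 0 < d"
    using u_deriv[of t] t assms by auto
qed (use u_cont_on assms in auto)

text \<open>
  The difference quotients of \<open>w\<close> over \<open>[0, r]\<close> and \<open>[r, a]\<close> are values of \<open>w' = \<kappa> u\<close> at a point
  left and a point right of \<open>r\<close>, and \<open>u\<close> increases.
\<close>

lemma momentum_below_chord:
  assumes "0 < r" and "r < a"
  shows "w r < r * w a / a"
proof -
  obtain y where y: "0 < y" "y < r" "w r = r * (\<kappa> * u y)"
  proof -
    have "\<exists>d z. 0 < z \<and> z < r \<and> (w has_real_derivative d) (at z) \<and> w r - w 0 = (r - 0) * d"
      using assms w_cont_on[of 0 r] w_deriv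
      by (intro MVT) (auto simp: real_differentiable_def, meson order_less_trans)
    then obtain d z where z: "0 < z" "z < r" "(w has_real_derivative d) (at z)" "w r = r * d"
      using w0 by auto
    moreover have "d = \<kappa> * u z"
      using DERIV_unique[OF z(3) w_deriv] z assms by simp
    ultimately show ?thesis
      using that by blast
  qed
  obtain z where z: "r < z" "z < a" "w a - w r = (a - r) * (\<kappa> * u z)"
  proof -
    have "\<exists>d z. r < z \<and> z < a \<and> (w has_real_derivative d) (at z) \<and> w a - w r = (a - r) * d"
      using assms w_cont_on[of r a] w_deriv
      by (intro MVT) (auto simp: real_differentiable_def, meson order_less_trans)
    then obtain d z where z: "r < z" "z < a" "(w has_real_derivative d) (at z)"
        "w a - w r = (a - r) * d"
      by auto
    moreover have "d = \<kappa> * u z"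
      using DERIV_unique[OF z(3) w_deriv] z assms by simp
    ultimately show ?thesis
      using that by blast
  qed
  have "\<kappa> * u y < \<kappa> * u z"
    using u_strict_mono[of y z] y z assms kappa_pos by simp
  then have "(r * (a - r)) * (\<kappa> * u y) < (r * (a - r)) * (\<kappa> * u z)"
    by (rule mult_strict_left_mono) (use assms in simp)
  moreover have "w r * (a - r) = (r * (a - r)) * (\<kappa> * u y)"
    by (simp add: y(3))
  moreover have "r * (w a - w r) = (r * (a - r)) * (\<kappa> * u z)"
    by (simp only: z(3) mult.assoc)
  ultimately have "w r * (a - r) < r * (w a - w r)"
    by (simp only:)
  then show ?thesis
    using a_pos by (simp add: field_simps)
qed


section \<open>Comparison with a hyperbola\<close>

text \<open>The radius for which the hyperbola \<open>sqrt (r\<^sup>2 + R\<^sup>2)\<close> has at \<open>a\<close> the momentum of \<open>u\<close>.\<close>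

definition R :: real
  where "R = a / w a"

definition hyperbola :: "real \<Rightarrow> real"
  where "hyperbola r = u a - sqrt (a\<^sup>2 + R\<^sup>2) + sqrt (r\<^sup>2 + R\<^sup>2)"

lemma R_pos: "R > 0"
  using w_pos[of a] a_pos by (simp add: R_def)

lemma sqrt_scale: "sqrt (1 + (r / R)\<^sup>2) = sqrt (r\<^sup>2 + R\<^sup>2) / R"
proof -
  have "1 + (r / R)\<^sup>2 = (r\<^sup>2 + R\<^sup>2) / R\<^sup>2"
    using R_pos by (simp add: field_simps)
  then show ?thesis
    using R_pos by (simp add: real_sqrt_divide)
qed

lemma hyperbola_deriv: "(hyperbola has_real_derivative slope (r / R)) (at r)"
proof -
  have "r\<^sup>2 + R\<^sup>2 > 0"
    using R_pos by (simp add: add_nonneg_pos)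
  then have "(hyperbola has_real_derivative r / sqrt (r\<^sup>2 + R\<^sup>2)) (at r)"
    unfolding hyperbola_def by (auto intro!: derivative_eq_intros simp: field_simps)
  moreover have "slope (r / R) = r / sqrt (r\<^sup>2 + R\<^sup>2)"
    using R_pos by (simp add: slope_def sqrt_scale)
  ultimately show ?thesis
    by simp
qed

text \<open>
  The momentum of the hyperbola is the chord of \<open>w\<close>, so \<open>u\<close> rises more slowly than the
  hyperbola; both reach the same height at \<open>a\<close>.
\<close>

lemma hyperbola_less:
  assumes "0 \<le> r" and "r < a"
  shows "hyperbola r < u r"
proof -
  let ?d = "\<lambda>x. hyperbola x - u x"
  have "?d r < ?d a"
  proof (rule DERIV_pos_imp_increasing_open[OF assms(2)])
    fix x assume x: "r < x" "x < a"
    then have "w x < x / R"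
      using momentum_below_chord[of x] assms by (simp add: R_def)
    then have "slope (x / R) - slope (w x) > 0"
      using slope_strict_mono by simp
    moreover have "(?d has_real_derivative slope (x / R) - slope (w x)) (at x)"
      using x assms by (intro DERIV_diff hyperbola_deriv u_deriv) auto
    ultimately show "\<exists>d. (?d has_real_derivative d) (at x) \<and> 0 < d"
      by blast
  next
    show "continuous_on {r..a} ?d"
      unfolding hyperbola_def using assms by (intro continuous_intros u_cont_on) auto
  qed
  then show ?thesis
    by (simp add: hyperbola_def)
qed

text \<open>
  The area under \<open>u\<close> is \<open>w a / \<kappa>\<close>. In place of integrals, \<open>w / \<kappa>\<close> is compared with an
  antiderivative of the hyperbola.
\<close>

lemma height_bound:
  "a * (u a - sqrt (a\<^sup>2 + R\<^sup>2)) + (a * sqrt (a\<^sup>2 + R\<^sup>2) + R\<^sup>2 * arsinh (a / R)) / 2 < w a / \<kappa>"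
proof -
  let ?c = "u a - sqrt (a\<^sup>2 + R\<^sup>2)"
  let ?V = "\<lambda>x. x * ?c + (x * sqrt (x\<^sup>2 + R\<^sup>2) + R\<^sup>2 * arsinh (x / R)) / 2"
  let ?d = "\<lambda>x. w x / \<kappa> - ?V x"
  have V: "(?V has_real_derivative hyperbola x) (at x)" for x
  proof -
    define q where "q = sqrt (x\<^sup>2 + R\<^sup>2)"
    have pos: "x\<^sup>2 + R\<^sup>2 > 0"
      using R_pos by (simp add: add_nonneg_pos)
    then have q: "q > 0" "q\<^sup>2 = x\<^sup>2 + R\<^sup>2"
      by (simp_all add: q_def)
    have "((\<lambda>x. arsinh (x / R)) has_real_derivative 1 / sqrt ((x / R)\<^sup>2 + 1) * (1 / R)) (at x)"
      using R_pos by (intro DERIV_chain2[OF arsinh_real_has_field_derivative])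
        (auto intro!: derivative_eq_intros)
    moreover have "1 / sqrt ((x / R)\<^sup>2 + 1) * (1 / R) = 1 / q"
      using R_pos sqrt_scale[of x] by (simp add: q_def add.commute)
    ultimately have A: "((\<lambda>x. arsinh (x / R)) has_real_derivative 1 / q) (at x)"
      by simp
    have B: "((\<lambda>x. sqrt (x\<^sup>2 + R\<^sup>2)) has_real_derivative x / q) (at x)"
      unfolding q_def using pos by (auto intro!: derivative_eq_intros simp: field_simps)
    have "((\<lambda>x. x * c + (x * g x + R\<^sup>2 * f x) / 2) has_real_derivative
        c + ((g x + x * g') + R\<^sup>2 * f') / 2) (at x)"
      if "(g has_real_derivative g') (at x)" "(f has_real_derivative f') (at x)" for c f g f' g'
      by (auto intro!: derivative_eq_intros that)
    from this[OF B A] have "(?V has_real_derivative ?c + ((q + x * (x / q)) + R\<^sup>2 * (1 / q)) / 2) (at x)"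
      by (simp only: q_def)
    moreover have "(q + x * (x / q)) + R\<^sup>2 * (1 / q) = 2 * q"
      using q by (simp add: field_simps power2_eq_square)
    ultimately have "(?V has_real_derivative ?c + 2 * q / 2) (at x)"
      by (simp only:)
    then show ?thesis
      by (simp add: hyperbola_def q_def)
  qed
  have "?d 0 < ?d a"
  proof (rule DERIV_pos_imp_increasing_open[OF a_pos])
    fix x assume x: "0 < x" "x < a"
    have "(?d has_real_derivative \<kappa> * u x / \<kappa> - hyperbola x) (at x)"
      by (intro DERIV_diff DERIV_cdivide w_deriv x V)
    moreover have "\<kappa> * u x / \<kappa> - hyperbola x > 0"
      using hyperbola_less[of x] x kappa_pos by simp
    ultimately show "\<exists>d. (?d has_real_derivative d) (at x) \<and> 0 < d"
      by blast
  next
    have "continuous_on {0..a} ?V"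
      by (rule DERIV_continuous_on[OF has_field_derivative_at_within[OF V]])
    then show "continuous_on {0..a} ?d"
      using kappa_pos by (intro continuous_on_diff continuous_on_divide continuous_on_const w_cont) auto
  qed
  then show ?thesis
    by (simp add: w0)
qed

end


section \<open>The bounds in terms of the boundary slope\<close>

lemma capillary_system_of_solution:
  assumes "\<kappa> > 0" and "a > 0" and "u 0 > 0" and "u' 0 = 0"
    and sol: "solves_capillary \<kappa> a u u' u''"
  shows "capillary_system \<kappa> a u (\<lambda>r. momentum (u' r))"
proof
  have u: "(u has_real_derivative u' r) (at r within {-a..a})" if "r \<in> {-a..a}" for r
    using sol that by (simp add: solves_capillary_def)
  have u'_less: "\<bar>u' r\<bar> < 1" if "r \<in> {-a..a}" for r
    using sol that by (simp add: solves_capillary_def)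
  have u'_cont: "continuous_on {0..a} u'"
    using sol \<open>a > 0\<close> by (auto simp: solves_capillary_def intro: continuous_on_subset)
  have "continuous_on {-a..a} u"
    using u by (rule DERIV_continuous_on)
  then show "continuous_on {0..a} u"
    using \<open>a > 0\<close> by (auto intro: continuous_on_subset)
  have "1 - (u' r)\<^sup>2 > 0" if "r \<in> {0..a}" for r
    using u'_less[of r] that \<open>a > 0\<close> by (simp add: abs_square_less_1)
  then have "\<forall>r\<in>{0..a}. sqrt (1 - (u' r)\<^sup>2) \<noteq> 0"
    by fastforce
  then show "continuous_on {0..a} (\<lambda>r. momentum (u' r))"
    unfolding momentum_def by (intro continuous_intros u'_cont)
  fix r assume r: "0 < r" "r < a"
  have "(u has_real_derivative u' r) (at r)"
    using u[of r] r at_within_Icc_at[of "-a" r a] by simp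
  then show "(u has_real_derivative slope (momentum (u' r))) (at r)"
    using u'_less[of r] r by (simp add: slope_momentum)
  have "(u' has_real_derivative u'' r) (at r)"
    and "u'' r / (1 - (u' r)\<^sup>2) powr (3/2) = \<kappa> * u r"
    using sol r by (simp_all add: solves_capillary_def)
  then show "((\<lambda>r. momentum (u' r)) has_real_derivative \<kappa> * u r) (at r)"
    using has_real_derivative_momentum[of u' "u'' r" r] u'_less[of r] r by simp
qed (use assms in \<open>auto simp: momentum_def\<close>)

theorem theorem5p5:
  fixes \<kappa> a u\<^sub>0 \<beta> :: real and u u' u'' :: "real \<Rightarrow> real"
  assumes "\<kappa> > 0" and "a > 0" and "u\<^sub>0 > 0"
    and "solves_capillary \<kappa> a u u' u''"
    and "u 0 = u\<^sub>0" and "u' 0 = 0"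
    and "u' a = tanh \<beta>" and "u' (-a) = - tanh \<beta>"
  shows "(\<forall>r. 0 \<le> r \<and> r < a \<longrightarrow>
            u a - a * coth \<beta> + sqrt (r\<^sup>2 + a\<^sup>2 / (sinh \<beta>)\<^sup>2) < u r)
       \<and> u a < sinh \<beta> / (\<kappa> * a) + a / 2 * coth \<beta> - a * \<beta> / (2 * (sinh \<beta>)\<^sup>2)"
proof -
  interpret capillary_system \<kappa> a u "\<lambda>r. momentum (u' r)"
    using assms by (intro capillary_system_of_solution) auto
  have wa: "momentum (u' a) = sinh \<beta>"
    using assms by (simp add: momentum_tanh)
  have sinh_pos: "sinh \<beta> > 0"
    using w_pos[of a] wa a_pos by simp
  have R: "R = a / sinh \<beta>"
    by (simp add: R_def wa)
  have "a\<^sup>2 + R\<^sup>2 = (a * cosh \<beta> / sinh \<beta>)\<^sup>2"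
    using sinh_pos by (simp add: R power_divide power_mult_distrib cosh_square_eq field_simps)
  then have sqrt_a: "sqrt (a\<^sup>2 + R\<^sup>2) = a * coth \<beta>"
    using sinh_pos a_pos by (simp add: coth_def)
  have "u a - a * coth \<beta> + sqrt (r\<^sup>2 + a\<^sup>2 / (sinh \<beta>)\<^sup>2) < u r" if "0 \<le> r \<and> r < a" for r
    using hyperbola_less[of r] that unfolding hyperbola_def sqrt_a by (simp add: R power_divide)
  moreover have "u a < sinh \<beta> / (\<kappa> * a) + a / 2 * coth \<beta> - a * \<beta> / (2 * (sinh \<beta>)\<^sup>2)"
  proof -
    have "a / R = sinh \<beta>"
      using a_pos by (simp add: R)
    then have "a * (u a - a * coth \<beta>) + (a * (a * coth \<beta>) + R\<^sup>2 * \<beta>) / 2 < sinh \<beta> / \<kappa>"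
      using height_bound unfolding sqrt_a wa by (simp add: arsinh_sinh_real)
    then have "(u a - a / 2 * coth \<beta> + a * \<beta> / (2 * (sinh \<beta>)\<^sup>2)) * a < sinh \<beta> / \<kappa>"
      by (simp add: R power_divide algebra_simps power2_eq_square add_divide_distrib)
    then have "u a - a / 2 * coth \<beta> + a * \<beta> / (2 * (sinh \<beta>)\<^sup>2) < sinh \<beta> / \<kappa> / a"
      using a_pos by (simp only: pos_less_divide_eq)
    then show ?thesis
      by simp
  qed
  ultimately show ?thesis
    by blast
qed

end
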